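(* Let $d\ge 2$ be an integer and let $\varepsilon>0$. Let $f_1,\ldots,f_{d+1}$ be orientation-preserving $C^1$ diffeomorphisms of the interval $[0,1]$ which commute with each other. Suppose that there exist pairwise disjoint non-empty open intervals $I_{n_1,\ldots,n_d}\subset\, ]0,1[$, indexed by $(n_1,\ldots,n_d)\in\mathbb{Z}^d$, which are arranged in $]0,1[$ respecting the lexicographic order of the indices and such that for every $(n_1,\ldots,n_d)\in\mathbb{Z}^d$ $$f_i(I_{n_1,\ldots,n_i,\ldots,n_d})=I_{n_1,\ldots,n_i-1,\ldots,n_d}\quad\text{for all } i\in\{1,\ldots,d\},\qquad f_{d+1}(I_{n_1,\ldots,n_d})=I_{n_1,\ldots,n_d}.$$ If $f_1,\ldots,f_d$ are of class $C^{1+1/d+\varepsilon}$, then the restriction of $f_{d+1}$ to the union of the intervals $I_{n_1,\ldots,n_d}$ is the identity.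
   Context: All transformations are orientation preserving. For $\tau\in(0,1)$, a diffeomorphism $f$ of $[0,1]$ is of class $C^{1+\tau}$ if it is $C^1$ and its derivative is $\tau$-Hölder on $[0,1]$: there is $C<\infty$ with $|f'(x)-f'(y)|\le C|x-y|^{\tau}$ for all $x,y$ (for exponents $\tau\ge1$ the class has its usual meaning and is contained in $C^{1+\sigma}$ for all $\sigma<1$). "Respecting the lexicographic order" means that $I_{n_1,\ldots,n_d}$ lies to the left of $I_{m_1,\ldots,m_d}$ whenever $(n_1,\ldots,n_d)$ precedes $(m_1,\ldots,m_d)$ in the lexicographic order of $\mathbb{Z}^d$. *)

theory Defs
  imports "HOL-Analysis.Analysis" "HOL-Library.Fun_Lexorder"
begin

(* Derivatives are taken within [0,1], hence one-sided at 0 and 1.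
   For integral r this is the usual C^r, with no Hoelder condition. *)
definition class_C :: "real \<Rightarrow> (real \<Rightarrow> real) \<Rightarrow> bool" where
  "class_C r f \<longleftrightarrow>
     (\<exists>D. D 0 = f \<and>
        (\<forall>j<nat \<lfloor>r\<rfloor>. \<forall>x\<in>{0..1}. (D j has_real_derivative D (Suc j) x) (at x within {0..1})) \<and>
        continuous_on {0..1} (D (nat \<lfloor>r\<rfloor>)) \<and>
        (frac r > 0 \<longrightarrow>
          (\<exists>C. \<forall>x\<in>{0..1}. \<forall>y\<in>{0..1}.
             \<bar>D (nat \<lfloor>r\<rfloor>) x - D (nat \<lfloor>r\<rfloor>) y\<bar> \<le> C * \<bar>x - y\<bar> powr frac r)))"

definition diffeo_plus :: "(real \<Rightarrow> real) \<Rightarrow> bool" where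
  "diffeo_plus f \<longleftrightarrow>
     bij_betw f {0..1} {0..1} \<and> strict_mono_on {0..1} f \<and>
     class_C 1 f \<and> class_C 1 (inv_into {0..1} f)"

(* Extensional functions, so that distinct elements differ at some index in {1..d}. In
   particular less_fun from Fun_Lexorder is the lexicographic order on this set. *)
definition Zd :: "nat \<Rightarrow> (nat \<Rightarrow> int) set" where
  "Zd d = {1..d} \<rightarrow>\<^sub>E UNIV"

lemma class_C_holder_derivative:
  assumes "0 < \<tau>" "\<tau> < 1"
  shows "class_C (1 + \<tau>) f \<longleftrightarrow>
     (\<exists>f'. (\<forall>x\<in>{0..1}. (f has_real_derivative f' x) (at x within {0..1})) \<and>
        continuous_on {0..1} f' \<and>
        (\<exists>C. \<forall>x\<in>{0..1}. \<forall>y\<in>{0..1}. \<bar>f' x - f' y\<bar> \<le> C * \<bar>x - y\<bar> powr \<tau>))"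
    (is "?L \<longleftrightarrow> ?R")
proof -
  have fl: "\<lfloor>1 + \<tau>\<rfloor> = 1" using assms by linarith
  have fr: "frac (1 + \<tau>) = \<tau>" using fl by (simp add: frac_def)
  show ?thesis
  proof
    assume ?L
    then show ?R unfolding class_C_def fl fr using assms(1) by auto
  next
    assume ?R
    then obtain f' C where f': "\<forall>x\<in>{0..1}. (f has_real_derivative f' x) (at x within {0..1})"
        "continuous_on {0..1} f'"
        "\<forall>x\<in>{0..1}. \<forall>y\<in>{0..1}. \<bar>f' x - f' y\<bar> \<le> C * \<bar>x - y\<bar> powr \<tau>" by blast
    show ?L unfolding class_C_def fl fr
      by (rule exI[of _ "\<lambda>j. if j = 0 then f else f'"]) (use f' in auto)
  qed
qed

lemma less_fun_Zd_iff:
  assumes "n \<in> Zd d" "m \<in> Zd d"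
  shows "less_fun n m \<longleftrightarrow> (\<exists>k\<in>{1..d}. n k < m k \<and> (\<forall>j\<in>{1..<k}. n j = m j))"
proof -
  have eq: "n j = m j" if "j \<notin> {1..d}" for j
    using assms that unfolding Zd_def by (metis PiE_arb)
  have eq0: "n 0 = m 0" by (rule eq) simp
  show ?thesis
  proof
    assume "less_fun n m"
    then obtain k where k: "n k < m k" "\<forall>j<k. n j = m j" unfolding less_fun_def by blast
    then have "k \<in> {1..d}" using eq[of k] by force
    with k show "\<exists>k\<in>{1..d}. n k < m k \<and> (\<forall>j\<in>{1..<k}. n j = m j)" by auto
  next
    assume "\<exists>k\<in>{1..d}. n k < m k \<and> (\<forall>j\<in>{1..<k}. n j = m j)"
    then obtain k where k: "n k < m k" "\<forall>j\<in>{1..<k}. n j = m j" by blast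
    have "n j = m j" if "j < k" for j
      using k(2) eq0 that by (cases j) auto
    then show "less_fun n m" unfolding less_fun_def using k(1) by blast
  qed
qed

end

theory Submission imports Defs begin

text \<open>
  Write \<open>g\<close> for the last map. The argument is Kopell's: suppose that some composition \<open>h\<close>
  of \<open>f\<^sub>1, \<dots>, f\<^sub>d\<close> carries an interval \<open>I\<^sub>p\<close> to a very short interval \<open>I\<^sub>q\<close>
  with distortion bounded by a constant \<open>E\<close> that does not depend on \<open>q\<close>. An iterate
  \<open>g\<^sup>m\<close> maps \<open>I\<^sub>q\<close> onto itself and is \<open>C\<^sup>1\<close>, so its derivative is almost constant on
  the short interval \<open>I\<^sub>q\<close> and cannot be small there
  (\<open>no_contraction_on_short_invariant_interval\<close>). Since \<open>h\<close> conjugates \<open>g\<^sup>m\<close>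
  on \<open>I\<^sub>p\<close> to \<open>g\<^sup>m\<close> on \<open>I\<^sub>q\<close>, the map \<open>g\<^sup>m\<close> cannot contract \<open>[x, g x]\<close> by more than
  the factor \<open>1 / (2 * E)\<close>, for any \<open>m\<close>. But \<open>g\<^sup>m x\<close> is a monotone bounded sequence,
  so its increments tend to 0, and therefore \<open>g x = x\<close>
  (\<open>fixed_point_if_displacement_bounded_below\<close>).

  It remains to find \<open>h\<close>. Moving along a lattice path from \<open>p\<close>, one generator at a time, yields a
  distortion of at most \<open>exp (M * (\<Sum> l\<^sup>\<tau>))\<close>, where the sum runs over the lengths \<open>l\<close> of the
  intervals visited and \<open>\<tau>\<close> is a Hoelder exponent (\<open>path_realization\<close>). So paths of arbitrary
  length are needed along which this sum is bounded by a constant. A random path provides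
  them: choose the transition probabilities of Polya's urn, so that the position after \<open>k\<close> steps is
  uniformly distributed among the \<open>N\<^sub>k = (k + d - 1) choose (d - 1)\<close> multi-indices of
  size \<open>k\<close>. The expected sum is then the sum over \<open>k\<close> of the averages of \<open>l\<^sup>\<tau>\<close> over these
  multi-indices (\<open>average_path_cost\<close>). As the intervals are disjoint, the total length is at most 1,
  and as \<open>N\<^sub>k\<close> grows like \<open>k\<^bsup>d - 1\<^esup>\<close>, the sum of the averages is bounded as soon
  as \<open>\<tau> > 1 / d\<close> (\<open>average_powr_bound\<close>). Some path is at most as expensive as the
  expected one (\<open>cheap_path\<close>).
\<close>

section \<open>Distortion\<close>

lemma mean_value_within:
  fixes G D :: "real \<Rightarrow> real"
  assumes D: "\<And>x. x \<in> {0..1} \<Longrightarrow> (G has_real_derivative D x) (at x within {0..1})"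
    and J: "{a<..<b} \<subseteq> {0..1}" and uv: "u \<in> {a<..<b}" "v \<in> {a<..<b}"
  obtains z where "z \<in> {a<..<b}" "\<bar>G u - G v\<bar> = \<bar>D z\<bar> * \<bar>u - v\<bar>"
proof -
  have *: "\<exists>z\<in>{a<..<b}. \<bar>G u - G v\<bar> = \<bar>D z\<bar> * \<bar>u - v\<bar>"
    if "u \<le> v" "u \<in> {a<..<b}" "v \<in> {a<..<b}" for u v
  proof -
    have sub: "{u..v} \<subseteq> {a<..<b}" using that by auto
    have "\<exists>z\<in>{u..v}. G v - G u = (\<lambda>h. D z * h) (v - u)"
    proof (rule mvt_very_simple[OF that(1)])
      fix x assume "u \<le> x" "x \<le> v"
      then have "x \<in> {0..1}" using sub J by (metis atLeastAtMost_iff subsetD)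
      from has_field_derivative_subset[OF D[OF this] order_trans[OF sub J]]
      show "(G has_derivative (\<lambda>h. D x * h)) (at x within {u..v})"
        by (simp add: has_field_derivative_def)
    qed
    then obtain z where "z \<in> {u..v}" "G v - G u = D z * (v - u)" by auto
    then have "z \<in> {a<..<b} \<and> \<bar>G u - G v\<bar> = \<bar>D z\<bar> * \<bar>u - v\<bar>"
      using sub by (metis abs_minus_commute abs_mult subsetD)
    then show ?thesis by blast
  qed
  show thesis
  proof (cases "u \<le> v")
    case True
    then show thesis using *[of u v] uv that by blast
  next
    case False
    then show thesis using *[of v u] uv that by (metis abs_minus_commute linear)
  qed
qed

text \<open>
  For a \<open>C\<^sup>1\<close> map \<open>h\<close> with nonvanishing derivative the smallest such \<open>E\<close> is the supremum of the ratios of two values of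
  \<open>\<bar>h'\<bar>\<close> on an interval \<open>A\<close>. Comparing difference quotients instead means that compositions of the
  generators never have to be differentiated; cross-multiplication avoids dividing by 0.
\<close>

definition distortion_le :: "(real \<Rightarrow> real) \<Rightarrow> real set \<Rightarrow> real \<Rightarrow> bool" where
  "distortion_le h A E \<longleftrightarrow>
     (\<forall>x\<in>A. \<forall>y\<in>A. \<forall>u\<in>A. \<forall>v\<in>A. \<bar>h y - h x\<bar> * \<bar>v - u\<bar> \<le> E * (\<bar>h v - h u\<bar> * \<bar>y - x\<bar>))"

lemma distortion_le_mono:
  assumes "distortion_le h A E" "E \<le> E'"
  shows "distortion_le h A E'"
  unfolding distortion_le_def
proof (intro ballI)
  fix x y u v assume "x \<in> A" "y \<in> A" "u \<in> A" "v \<in> A"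
  then have "\<bar>h y - h x\<bar> * \<bar>v - u\<bar> \<le> E * (\<bar>h v - h u\<bar> * \<bar>y - x\<bar>)"
    using assms(1) unfolding distortion_le_def by blast
  also have "\<dots> \<le> E' * (\<bar>h v - h u\<bar> * \<bar>y - x\<bar>)"
    using assms(2) by (intro mult_right_mono) auto
  finally show "\<bar>h y - h x\<bar> * \<bar>v - u\<bar> \<le> E' * (\<bar>h v - h u\<bar> * \<bar>y - x\<bar>)" .
qed

lemma distortion_le_comp:
  assumes h: "distortion_le h A E" and f: "distortion_le f B E'"
    and inj: "inj_on h A" and hA: "h ` A \<subseteq> B" and E': "0 \<le> E'"
  shows "distortion_le (f \<circ> h) A (E * E')"
  unfolding distortion_le_def
proof (intro ballI)
  fix x y u v assume xyuv: "x \<in> A" "y \<in> A" "u \<in> A" "v \<in> A"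
  show "\<bar>(f \<circ> h) y - (f \<circ> h) x\<bar> * \<bar>v - u\<bar> \<le> E * E' * (\<bar>(f \<circ> h) v - (f \<circ> h) u\<bar> * \<bar>y - x\<bar>)"
  proof (cases "u = v")
    case False
    then have pos: "\<bar>h v - h u\<bar> > 0" using inj xyuv by (auto dest: inj_onD)
    have 1: "\<bar>f (h y) - f (h x)\<bar> * \<bar>h v - h u\<bar> \<le> E' * (\<bar>f (h v) - f (h u)\<bar> * \<bar>h y - h x\<bar>)"
      using f hA xyuv unfolding distortion_le_def by blast
    have 2: "\<bar>h y - h x\<bar> * \<bar>v - u\<bar> \<le> E * (\<bar>h v - h u\<bar> * \<bar>y - x\<bar>)"
      using h xyuv unfolding distortion_le_def by blast
    have "\<bar>f (h y) - f (h x)\<bar> * \<bar>v - u\<bar> * \<bar>h v - h u\<bar>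
        \<le> E' * (\<bar>f (h v) - f (h u)\<bar> * \<bar>h y - h x\<bar>) * \<bar>v - u\<bar>"
      using mult_right_mono[OF 1, of "\<bar>v - u\<bar>"] by (simp add: mult_ac)
    also have "\<dots> = (E' * \<bar>f (h v) - f (h u)\<bar>) * (\<bar>h y - h x\<bar> * \<bar>v - u\<bar>)"
      by (simp add: mult_ac)
    also have "\<dots> \<le> (E' * \<bar>f (h v) - f (h u)\<bar>) * (E * (\<bar>h v - h u\<bar> * \<bar>y - x\<bar>))"
      by (rule mult_left_mono[OF 2]) (simp add: E')
    also have "\<dots> = (E * E' * (\<bar>f (h v) - f (h u)\<bar> * \<bar>y - x\<bar>)) * \<bar>h v - h u\<bar>"
      by (simp add: mult_ac)
    finally show ?thesis using pos by simp
  qed simp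
qed

text \<open>
  On an interval of length \<open>b - a\<close>, two values of \<open>D\<close> differ by at most \<open>C * (b - a)\<^sup>\<tau>\<close> and both are at
  least \<open>c\<close>, so their ratio is at most \<open>1 + C / c * (b - a)\<^sup>\<tau>\<close>, which the exponential dominates.
  The exponential form makes the bounds add up in the exponent under composition.
\<close>

lemma distortion_le_Hoelder:
  fixes D :: "real \<Rightarrow> real"
  assumes D: "\<And>x. x \<in> {0..1} \<Longrightarrow> (f has_real_derivative D x) (at x within {0..1})"
    and c: "c > 0" "\<And>x. x \<in> {0..1} \<Longrightarrow> c \<le> D x"
    and C: "\<And>x y. x \<in> {0..1} \<Longrightarrow> y \<in> {0..1} \<Longrightarrow> \<bar>D x - D y\<bar> \<le> C * \<bar>x - y\<bar> powr \<tau>"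
    and "0 \<le> C" "0 \<le> \<tau>" and J: "{a<..<b} \<subseteq> {0..1}"
  shows "distortion_le f {a<..<b} (exp (C / c * (b - a) powr \<tau>))"
  unfolding distortion_le_def
proof (intro ballI)
  fix x y u v assume xyuv: "x \<in> {a<..<b}" "y \<in> {a<..<b}" "u \<in> {a<..<b}" "v \<in> {a<..<b}"
  obtain z where z: "z \<in> {a<..<b}" "\<bar>f y - f x\<bar> = \<bar>D z\<bar> * \<bar>y - x\<bar>"
    using mean_value_within[OF D J xyuv(2,1)] by blast
  obtain w where w: "w \<in> {a<..<b}" "\<bar>f v - f u\<bar> = \<bar>D w\<bar> * \<bar>v - u\<bar>"
    using mean_value_within[OF D J xyuv(4,3)] by blast
  have zw: "z \<in> {0..1}" "w \<in> {0..1}" using z w J by auto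
  define K where "K = C / c * (b - a) powr \<tau>"
  have K0: "0 \<le> K" using assms unfolding K_def by auto
  have "D z - D w \<le> C * \<bar>z - w\<bar> powr \<tau>" using C[OF zw] by linarith
  also have "\<dots> \<le> C * (b - a) powr \<tau>"
    using z(1) w(1) \<open>0 \<le> C\<close> \<open>0 \<le> \<tau>\<close> by (intro mult_left_mono powr_mono2) auto
  also have "\<dots> = c * K" using c(1) by (simp add: K_def)
  also have "\<dots> \<le> D w * K" using c(2)[OF zw(2)] K0 by (rule mult_right_mono)
  finally have "D z \<le> D w * (1 + K)" by (simp add: algebra_simps)
  also have "\<dots> \<le> D w * exp K"
    using c(2)[OF zw(2)] c(1) by (intro mult_left_mono) auto
  finally have "\<bar>D z\<bar> \<le> exp K * \<bar>D w\<bar>"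
    using c(1) c(2)[OF zw(1)] c(2)[OF zw(2)] by (simp add: mult.commute)
  from mult_right_mono[OF this, of "\<bar>y - x\<bar> * \<bar>v - u\<bar>"]
  show "\<bar>f y - f x\<bar> * \<bar>v - u\<bar> \<le> exp (C / c * (b - a) powr \<tau>) * (\<bar>f v - f u\<bar> * \<bar>y - x\<bar>)"
    unfolding z(2) w(2) K_def[symmetric] by (simp add: mult_ac)
qed

lemma class_C_1_derivative:
  assumes "class_C 1 f"
  obtains D where "\<And>x. x \<in> {0..1} \<Longrightarrow> (f has_real_derivative D x) (at x within {0..1})"
    and "continuous_on {0..1} D"
proof -
  obtain D where "D 0 = f" "\<forall>j<1. \<forall>x\<in>{0..1}. (D j has_real_derivative D (Suc j) x) (at x within {0..1})"
     "continuous_on {0..1} (D 1)"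
    using assms unfolding class_C_def by auto
  then show thesis using that[of "D 1"] by auto
qed

text \<open>
  Below \<open>r = 2\<close> the derivative has Hoelder exponent \<open>r - 1 \<ge> \<tau>\<close>; from \<open>r = 2\<close> on it is Lipschitz.
  Exponents may be lowered because distances in \<open>[0,1]\<close> are at most 1.
\<close>

lemma class_C_imp_Hoelder_derivative:
  assumes r: "class_C r f" and \<tau>: "0 < \<tau>" "\<tau> < 1" "1 + \<tau> \<le> r"
  obtains D C where "\<And>x. x \<in> {0..1} \<Longrightarrow> (f has_real_derivative D x) (at x within {0..1})"
    and "continuous_on {0..1} D" and "0 \<le> C"
    and "\<And>x y. x \<in> {0..1} \<Longrightarrow> y \<in> {0..1} \<Longrightarrow> \<bar>D x - D y\<bar> \<le> C * \<bar>x - y\<bar> powr \<tau>"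
proof -
  from r obtain D where D: "D 0 = f"
    "\<And>j x. j < nat \<lfloor>r\<rfloor> \<Longrightarrow> x \<in> {0..1} \<Longrightarrow> (D j has_real_derivative D (Suc j) x) (at x within {0..1})"
    "continuous_on {0..1} (D (nat \<lfloor>r\<rfloor>))"
    "frac r > 0 \<longrightarrow> (\<exists>C. \<forall>x\<in>{0..1}. \<forall>y\<in>{0..1}.
             \<bar>D (nat \<lfloor>r\<rfloor>) x - D (nat \<lfloor>r\<rfloor>) y\<bar> \<le> C * \<bar>x - y\<bar> powr frac r)"
    unfolding class_C_def by blast
  have fl: "1 \<le> \<lfloor>r\<rfloor>" using \<tau> by linarith
  have cont: "continuous_on {0..1} (D j)" if "j \<le> nat \<lfloor>r\<rfloor>" for j
  proof (cases "j = nat \<lfloor>r\<rfloor>")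
    case False
    then show ?thesis using D(2)[of j] that
      by (intro DERIV_continuous_on) auto
  qed (use D(3) in simp)
  have d1: "(f has_real_derivative D 1 x) (at x within {0..1})" if "x \<in> {0..1}" for x
    using D(2)[of 0 x] D(1) fl that by simp
  have c1: "continuous_on {0..1} (D 1)" using cont[of 1] fl by (simp add: nat_le_iff le_nat_iff)
  have "\<exists>C \<sigma>. \<tau> \<le> \<sigma> \<and> (\<forall>x\<in>{0..1}. \<forall>y\<in>{0..1}. \<bar>D 1 x - D 1 y\<bar> \<le> C * \<bar>x - y\<bar> powr \<sigma>)"
  proof (cases "\<lfloor>r\<rfloor> = 1")
    case True
    then have "\<tau> \<le> frac r" using \<tau>(3) by (simp add: frac_def)
    moreover from this D(4) \<tau>(1) obtain C where
      "\<forall>x\<in>{0..1}. \<forall>y\<in>{0..1}. \<bar>D (nat \<lfloor>r\<rfloor>) x - D (nat \<lfloor>r\<rfloor>) y\<bar> \<le> C * \<bar>x - y\<bar> powr frac r"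
      by (meson less_le_trans)
    moreover have "nat \<lfloor>r\<rfloor> = 1" using True by simp
    ultimately show ?thesis by metis
  next
    case False
    then have 2: "2 \<le> nat \<lfloor>r\<rfloor>" using fl by linarith
    have d2: "(D 1 has_real_derivative D 2 x) (at x within {0..1})" if "x \<in> {0..1}" for x
      using D(2)[of 1 x] 2 that by (metis Suc_1 Suc_le_lessD)
    have "bounded (D 2 ` {0..1})"
      using cont[OF 2] by (intro compact_imp_bounded compact_continuous_image) auto
    then obtain B where B: "\<And>x. x \<in> {0..1} \<Longrightarrow> norm (D 2 x) \<le> B"
      unfolding bounded_iff by blast
    have "norm (D 1 x - D 1 y) \<le> B * norm (x - y)" if "x \<in> {0..1}" "y \<in> {0..1}" for x y
      by (rule field_differentiable_bound[OF _ d2 B]) (use that in auto)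
    then show ?thesis using \<tau>(2) by (intro exI[of _ B] exI[of _ 1]) auto
  qed
  then obtain C \<sigma> where C: "\<tau> \<le> \<sigma>"
    "\<And>x y. x \<in> {0..1} \<Longrightarrow> y \<in> {0..1} \<Longrightarrow> \<bar>D 1 x - D 1 y\<bar> \<le> C * \<bar>x - y\<bar> powr \<sigma>"
    by blast
  have "\<bar>D 1 x - D 1 y\<bar> \<le> \<bar>C\<bar> * \<bar>x - y\<bar> powr \<tau>" if "x \<in> {0..1}" "y \<in> {0..1}" for x y
  proof -
    have "\<bar>D 1 x - D 1 y\<bar> \<le> C * \<bar>x - y\<bar> powr \<sigma>" using C(2) that by blast
    also have "\<dots> \<le> \<bar>C\<bar> * \<bar>x - y\<bar> powr \<sigma>" by (intro mult_right_mono) auto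
    also have "\<dots> \<le> \<bar>C\<bar> * \<bar>x - y\<bar> powr \<tau>"
      using that C(1) by (intro mult_left_mono powr_mono') auto
    finally show ?thesis .
  qed
  then show thesis using that[of "D 1" "\<bar>C\<bar>"] d1 c1 by auto
qed

text \<open>
  Monotonicity gives \<open>Dx \<ge> 0\<close>, and the chain rule applied to the differentiable inverse
  excludes \<open>Dx = 0\<close>.
\<close>

lemma diffeo_plus_derivative_pos:
  assumes f: "diffeo_plus f"
    and D: "(f has_real_derivative Dx) (at x within {0..1})" and x: "x \<in> {0..1}"
  shows "0 < Dx"
proof -
  have bij: "bij_betw f {0..1} {0..1}" and mono: "strict_mono_on {0..1} f"
    and inv: "class_C 1 (inv_into {0..1} f)"
    using f by (auto simp: diffeo_plus_def)
  obtain E where E: "\<And>x. x \<in> {0..1} \<Longrightarrow>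
      (inv_into {0..1} f has_real_derivative E x) (at x within {0..1})"
    using class_C_1_derivative[OF inv] by blast
  have fx: "f x \<in> {0..1}" using bij x by (auto simp: bij_betw_def)
  have nontriv: "at x within {0..1} \<noteq> bot"
    using x connected_imp_perfect[of "{0..1::real}" x]
    by (auto simp: trivial_limit_within connected_Icc)
  have "((inv_into {0..1} f \<circ> f) has_real_derivative E (f x) * Dx) (at x within {0..1})"
    using E[OF fx] bij by (intro DERIV_image_chain[OF _ D]) (simp add: bij_betw_def)
  moreover have "((\<lambda>x. x) has_real_derivative 1) (at x within {0..1})" by simp
  then have "((inv_into {0..1} f \<circ> f) has_real_derivative 1) (at x within {0..1})"
    by (rule has_field_derivative_transform_within[of _ _ _ _ 1])
       (use bij x in \<open>auto simp: bij_betw_def\<close>)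
  ultimately have "E (f x) * Dx = 1"
    by (rule has_field_derivative_unique[OF _ _ nontriv])
  moreover have "0 \<le> Dx"
  proof (rule tendsto_lowerbound[OF _ _ nontriv])
    show "((\<lambda>y. (f y - f x) / (y - x)) \<longlongrightarrow> Dx) (at x within {0..1})"
      using D by (simp add: has_field_derivative_iff)
    have "0 \<le> (f y - f x) / (y - x)" if "y \<in> {0..1}" "y \<noteq> x" for y
      using strict_mono_onD[OF mono, of x y] strict_mono_onD[OF mono, of y x] that x
      by (cases "x < y") (auto intro!: divide_nonneg_nonneg divide_nonpos_nonpos)
    then show "\<forall>\<^sub>F y in at x within {0..1}. 0 \<le> (f y - f x) / (y - x)"
      by (auto simp: eventually_at_filter)
  qed
  ultimately show ?thesis by (cases "Dx = 0") auto
qed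

lemma diffeo_plus_distortion_le:
  assumes f: "diffeo_plus f" and r: "class_C r f" and \<tau>: "0 < \<tau>" "\<tau> < 1" "1 + \<tau> \<le> r"
  shows "\<exists>M\<ge>0. \<forall>a b. {a<..<b} \<subseteq> {0..1} \<longrightarrow>
           distortion_le f {a<..<b} (exp (M * (b - a) powr \<tau>))"
proof -
  obtain D C where D: "\<And>x. x \<in> {0..1} \<Longrightarrow> (f has_real_derivative D x) (at x within {0..1})"
    and cont: "continuous_on {0..1} D" and C: "0 \<le> C"
      "\<And>x y. x \<in> {0..1} \<Longrightarrow> y \<in> {0..1} \<Longrightarrow> \<bar>D x - D y\<bar> \<le> C * \<bar>x - y\<bar> powr \<tau>"
    using class_C_imp_Hoelder_derivative[OF r \<tau>] by blast
  obtain z where z: "z \<in> {0..1}" "\<And>x. x \<in> {0..1} \<Longrightarrow> D z \<le> D x"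
    using continuous_attains_inf[OF _ _ cont] by auto
  have pos: "0 < D z" by (rule diffeo_plus_derivative_pos[OF f D[OF z(1)] z(1)])
  show ?thesis
    by (rule exI[of _ "C / D z"])
       (use distortion_le_Hoelder[OF D pos z(2) C(2,1)] pos C(1) \<tau>(1) in auto)
qed

lemma funpow_C1:
  fixes g D :: "real \<Rightarrow> real"
  assumes D: "\<And>x. x \<in> {0..1} \<Longrightarrow> (g has_real_derivative D x) (at x within {0..1})"
    and cont: "continuous_on {0..1} D" and g: "g ` {0..1} \<subseteq> {0..1}"
  shows "\<exists>E. (\<forall>x\<in>{0..1}. (g ^^ m has_real_derivative E x) (at x within {0..1})) \<and>
             continuous_on {0..1} E"
proof (induction m)
  case 0
  show ?case by (rule exI[of _ "\<lambda>_. 1"]) (auto simp: id_def)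
next
  case (Suc m)
  then obtain E where E: "\<And>x. x \<in> {0..1} \<Longrightarrow> (g ^^ m has_real_derivative E x) (at x within {0..1})"
    "continuous_on {0..1} E" by blast
  have cg: "continuous_on {0..1} g" using D by (rule DERIV_continuous_on)
  have "(g ^^ Suc m has_real_derivative E (g x) * D x) (at x within {0..1})"
    if "x \<in> {0..1}" for x
    unfolding funpow_Suc_right
    using that g by (intro DERIV_image_chain[OF _ D] has_field_derivative_subset[OF E(1) g])
                    (simp_all add: image_subset_iff)
  moreover have "continuous_on {0..1} (\<lambda>x. E (g x) * D x)"
    using continuous_on_compose2[OF E(2) cg g] cont by (intro continuous_on_mult)
  ultimately show ?case by (intro exI[of _ "\<lambda>x. E (g x) * D x"] conjI ballI)
qed

text \<open>
  Uniform continuity makes \<open>D\<close> almost constant on a short interval. If \<open>\<bar>D\<bar>\<close> were less than \<open>1/2\<close>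
  somewhere on it, then \<open>\<bar>D\<bar> \<le> 3/4\<close> throughout, so that the interval would be mapped
  into a strictly shorter one.
\<close>

lemma no_contraction_on_short_invariant_interval:
  fixes G D :: "real \<Rightarrow> real"
  assumes D: "\<And>x. x \<in> {0..1} \<Longrightarrow> (G has_real_derivative D x) (at x within {0..1})"
    and cont: "continuous_on {0..1} D"
  shows "\<exists>\<delta>>0. \<forall>a b. {a<..<b} \<subseteq> {0..1} \<longrightarrow> b - a < \<delta> \<longrightarrow> G ` {a<..<b} = {a<..<b} \<longrightarrow>
           (\<forall>u\<in>{a<..<b}. \<forall>v\<in>{a<..<b}. \<bar>u - v\<bar> / 2 \<le> \<bar>G u - G v\<bar>)"
proof -
  have "uniformly_continuous_on {0..1} D"
    using cont by (intro compact_uniformly_continuous) auto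
  then obtain \<delta> where \<delta>: "\<delta> > 0"
    "\<And>x y. x \<in> {0..1} \<Longrightarrow> y \<in> {0..1} \<Longrightarrow> \<bar>y - x\<bar> < \<delta> \<Longrightarrow> \<bar>D y - D x\<bar> < 1/4"
    unfolding uniformly_continuous_on_def dist_real_def by (metis zero_less_divide_1_iff zero_less_numeral)
  have "\<bar>u - v\<bar> / 2 \<le> \<bar>G u - G v\<bar>"
    if J: "{a<..<b} \<subseteq> {0..1}" and ba: "b - a < \<delta>" and G: "G ` {a<..<b} = {a<..<b}"
      and uv: "u \<in> {a<..<b}" "v \<in> {a<..<b}" for a b u v
  proof -
    have "1/2 \<le> \<bar>D w\<bar>" if w: "w \<in> {a<..<b}" for w
    proof (rule ccontr)
      assume "\<not> 1/2 \<le> \<bar>D w\<bar>"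
      have small: "\<bar>D z\<bar> \<le> 3/4" if "z \<in> {a<..<b}" for z
      proof -
        have "\<bar>D z - D w\<bar> < 1/4" using that w J ba by (intro \<delta>(2)) auto
        then show ?thesis using \<open>\<not> 1/2 \<le> \<bar>D w\<bar>\<close> by linarith
      qed
      \<comment> \<open>The margin \<open>s\<close> keeps the two test points inside the open interval and still more than
          \<open>3/4 * (b - a)\<close> apart.\<close>
      define s where "s = (b - a) / 16"
      have s: "0 < s" using uv by (auto simp: s_def)
      have "a + s \<in> G ` {a<..<b}" "b - s \<in> G ` {a<..<b}" using s unfolding G by (auto simp: s_def field_simps)
      then obtain p q where pq: "p \<in> {a<..<b}" "q \<in> {a<..<b}" "G p = a + s" "G q = b - s"
        by fastforce
      obtain z where z: "z \<in> {a<..<b}" "\<bar>G q - G p\<bar> = \<bar>D z\<bar> * \<bar>q - p\<bar>"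
        using mean_value_within[OF D J pq(2,1)] by blast
      have "\<bar>D z\<bar> * \<bar>q - p\<bar> \<le> 3/4 * (b - a)"
        using small[OF z(1)] pq(1,2) by (intro mult_mono) auto
      then have "\<bar>G q - G p\<bar> \<le> 3/4 * (b - a)" using z(2) by simp
      moreover have "G q - G p = 7/8 * (b - a)" using pq by (simp add: s_def field_simps)
      ultimately show False using s by (simp add: s_def)
    qed
    moreover obtain z where "z \<in> {a<..<b}" "\<bar>G u - G v\<bar> = \<bar>D z\<bar> * \<bar>u - v\<bar>"
      using mean_value_within[OF D J uv] by blast
    ultimately show ?thesis using mult_right_mono[of "1/2" "\<bar>D z\<bar>" "\<bar>u - v\<bar>"] by force
  qed
  with \<delta>(1) show ?thesis by blast
qed

section \<open>Cheap lattice paths\<close>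

definition level :: "nat set \<Rightarrow> nat \<Rightarrow> (nat \<Rightarrow> nat) set" where
  "level A k = {n. (\<forall>i. i \<notin> A \<longrightarrow> n i = 0) \<and> sum n A = k}"

lemma finite_level:
  assumes "finite A"
  shows "finite (level A k)"
proof (rule finite_subset)
  show "level A k \<subseteq> {n. \<forall>i. (i \<in> A \<longrightarrow> n i \<in> {..k}) \<and> (i \<notin> A \<longrightarrow> n i = 0)}"
    using member_le_sum[OF _ _ assms] by (fastforce simp: level_def)
  show "finite {n. \<forall>i. (i \<in> A \<longrightarrow> n i \<in> {..k}) \<and> (i \<notin> A \<longrightarrow> n i = (0::nat))}"
    using assms by (intro finite_set_of_finite_funs) auto
qed

lemma level_0: "finite A \<Longrightarrow> level A 0 = {\<lambda>_. 0}"
  by (auto simp: level_def fun_eq_iff)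

lemma level_step:
  assumes "finite A" "i \<in> A" "n \<in> level A k"
  shows "n(i := Suc (n i)) \<in> level A (Suc k)"
proof -
  have "sum (n(i := Suc (n i))) A = Suc (sum n A)"
    using assms by (simp add: sum.remove[of A i] )
  then show ?thesis using assms by (auto simp: level_def)
qed

lemma level_step_back:
  assumes "finite A" "i \<in> A" "n \<in> level A (Suc k)" "n i > 0"
  shows "n(i := n i - 1) \<in> level A k"
proof -
  have "sum (n(i := n i - 1)) A + 1 = sum n A"
    using assms by (simp add: sum.remove[of A i] )
  then show ?thesis using assms by (auto simp: level_def)
qed

text \<open>
  The urn identity: passing from the uniform average over one level to the uniform average over the
  next is the same as distributing the weight of \<open>n\<close> over its predecessors \<open>n(i := n i - 1)\<close> in
  proportion to \<open>n i\<close>. A multi-index \<open>m\<close> then receives the weight \<open>m i + 1\<close> from its successor in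
  direction \<open>i\<close>, and these weights add up to \<open>k + card A\<close>, whichever \<open>m\<close> is chosen.
\<close>

lemma sum_level_Suc:
  fixes F :: "(nat \<Rightarrow> nat) \<Rightarrow> real"
  assumes A: "finite A"
  shows "(\<Sum>n\<in>level A (Suc k). \<Sum>i\<in>A. real (n i) * F (n(i := n i - 1)))
       = real (k + card A) * sum F (level A k)"
proof -
  have "(\<Sum>n\<in>level A (Suc k). \<Sum>i\<in>A. real (n i) * F (n(i := n i - 1)))
      = (\<Sum>i\<in>A. \<Sum>n\<in>level A (Suc k). real (n i) * F (n(i := n i - 1)))"
    by (rule sum.swap)
  also have "\<dots> = (\<Sum>i\<in>A. \<Sum>n\<in>level A k. real (Suc (n i)) * F n)"
  proof (rule sum.cong[OF refl])
    fix i assume i: "i \<in> A"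
    have "(\<Sum>n\<in>level A (Suc k). real (n i) * F (n(i := n i - 1)))
        = (\<Sum>n\<in>{n\<in>level A (Suc k). n i > 0}. real (n i) * F (n(i := n i - 1)))"
      by (rule sum.mono_neutral_right) (auto simp: finite_level A)
    also have "\<dots> = (\<Sum>n\<in>level A k. real (Suc (n i)) * F n)"
      by (rule sum.reindex_bij_witness[of _ "\<lambda>n. n(i := Suc (n i))" "\<lambda>n. n(i := n i - 1)"])
         (use level_step[OF A i] level_step_back[OF A i] in auto)
    finally show "(\<Sum>n\<in>level A (Suc k). real (n i) * F (n(i := n i - 1)))
        = (\<Sum>n\<in>level A k. real (Suc (n i)) * F n)" .
  qed
  also have "\<dots> = (\<Sum>n\<in>level A k. \<Sum>i\<in>A. real (Suc (n i)) * F n)"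
    by (rule sum.swap)
  also have "\<dots> = (\<Sum>n\<in>level A k. real (k + card A) * F n)"
  proof (rule sum.cong[OF refl])
    fix n assume "n \<in> level A k"
    then have "(\<Sum>i\<in>A. real (Suc (n i))) = real (k + card A)"
      by (simp add: level_def sum.distrib flip: of_nat_sum)
    then show "(\<Sum>i\<in>A. real (Suc (n i)) * F n) = real (k + card A) * F n"
      by (metis sum_distrib_right)
  qed
  finally show ?thesis by (simp add: sum_distrib_left)
qed

lemma card_level_Suc:
  assumes "finite A"
  shows "Suc k * card (level A (Suc k)) = (k + card A) * card (level A k)"
proof -
  have "(\<Sum>n\<in>level A (Suc k). \<Sum>i\<in>A. real (n i)) = (\<Sum>n\<in>level A (Suc k). real (Suc k))"
    by (rule sum.cong) (auto simp: level_def simp flip: of_nat_sum)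
  then have "real (Suc k * card (level A (Suc k))) = real ((k + card A) * card (level A k))"
    using sum_level_Suc[OF assms, of "\<lambda>_. 1" k] by (simp add: algebra_simps)
  then show ?thesis by (simp only: of_nat_eq_iff)
qed

lemma card_level:
  assumes A: "finite A" and "card A = Suc e"
  shows "card (level A k) = (k + e) choose e"
proof (induction k)
  case 0
  then show ?case by (simp add: level_0[OF A])
next
  case (Suc k)
  have "Suc k * card (level A (Suc k)) = Suc (k + e) * ((k + e) choose k)"
    using card_level_Suc[OF A, of k] assms(2) Suc binomial_symmetric[of e "k + e"] by simp
  also have "\<dots> = Suc k * (Suc (k + e) choose Suc k)"
    by (rule Suc_times_binomial[symmetric])
  finally have "card (level A (Suc k)) = (Suc (k + e) choose Suc k)"
    by (metis mult_left_cancel nat.distinct(1))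
  then show ?case using binomial_symmetric[of e "Suc k + e"] by simp
qed

text \<open>
  The cost omits the endpoint of the path: leaving \<open>n\<close> applies a generator to the interval at \<open>n\<close>,
  and it is this application that distorts.
\<close>

inductive path_cost :: "nat set \<Rightarrow> ((nat \<Rightarrow> nat) \<Rightarrow> real) \<Rightarrow> (nat \<Rightarrow> nat) \<Rightarrow> real \<Rightarrow> bool"
  for A c where
  start: "path_cost A c (\<lambda>_. 0) 0"
| step: "path_cost A c n s \<Longrightarrow> i \<in> A \<Longrightarrow> path_cost A c (n(i := Suc (n i))) (s + c n)"

lemma convex_combination_ge_some:
  fixes w :: "nat \<Rightarrow> nat" and X :: "nat \<Rightarrow> real"
  assumes "sum w A = Suc k"
  shows "\<exists>i\<in>A. w i > 0 \<and> X i \<le> (\<Sum>i\<in>A. real (w i) * X i) / real (Suc k)"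
proof (rule ccontr)
  define Y where "Y = (\<Sum>i\<in>A. real (w i) * X i) / real (Suc k)"
  assume "\<not> ?thesis"
  then have less: "Y < X i" if "i \<in> A" "w i > 0" for i using that by (auto simp: Y_def not_le)
  have fin: "finite A" using assms by (metis nat.distinct(1) sum.infinite)
  obtain j where j: "j \<in> A" "w j > 0" using assms by (metis gr0I nat.distinct(1) sum.neutral)
  have "(\<Sum>i\<in>A. real (w i) * Y) < (\<Sum>i\<in>A. real (w i) * X i)"
  proof (rule sum_strict_mono_ex1[OF fin])
    show "\<forall>i\<in>A. real (w i) * Y \<le> real (w i) * X i"
      using less by (metis bot_nat_0.not_eq_extremum less_eq_real_def mult_left_mono mult_zero_left of_nat_0 of_nat_0_le_iff)
    show "\<exists>i\<in>A. real (w i) * Y < real (w i) * X i" using less[OF j] j by (intro bexI[of _ j]) auto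
  qed
  moreover have "(\<Sum>i\<in>A. real (w i) * Y) = real (Suc k) * Y"
    using assms by (simp flip: sum_distrib_right of_nat_sum)
  ultimately show False by (simp add: Y_def)
qed

text \<open>
  \<open>F n\<close> is the expected cost of a random path conditioned on arriving at \<open>n\<close>. Given the arrival
  at \<open>n\<close>, the last step was in direction \<open>i\<close> with probability \<open>n i / (k + 1)\<close>; since these
  probabilities add up to 1, one of the predecessors is at most as expensive as their
  mean. By the urn identity the mean over each level is taken with respect to the uniform distribution.
\<close>

lemma average_path_cost:
  assumes A: "finite A" "A \<noteq> {}"
  shows "\<exists>F. (\<forall>n\<in>level A k. \<exists>s\<le>F n. path_cost A c n s) \<and>
             sum F (level A k) / card (level A k) = (\<Sum>j<k. sum c (level A j) / card (level A j))"
proof (induction k)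
  case 0
  show ?case by (rule exI[of _ "\<lambda>_. 0"]) (auto simp: level_0[OF A(1)] intro: path_cost.start)
next
  case (Suc k)
  then obtain F where F: "\<And>n. n \<in> level A k \<Longrightarrow> \<exists>s\<le>F n. path_cost A c n s"
    "sum F (level A k) / card (level A k) = (\<Sum>j<k. sum c (level A j) / card (level A j))"
    by blast
  define G where "G m = F m + c m" for m
  define F' where "F' n = (\<Sum>i\<in>A. real (n i) * G (n(i := n i - 1))) / real (Suc k)" for n
  have "\<exists>s\<le>F' n. path_cost A c n s" if n: "n \<in> level A (Suc k)" for n
  proof -
    have "sum n A = Suc k" using n by (simp add: level_def)
    from convex_combination_ge_some[OF this, of "\<lambda>i. G (n(i := n i - 1))"]
    obtain i where i: "i \<in> A" "n i > 0" "G (n(i := n i - 1)) \<le> F' n"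
      unfolding F'_def by blast
    obtain s where s: "s \<le> F (n(i := n i - 1))" "path_cost A c (n(i := n i - 1)) s"
      using F(1)[OF level_step_back[OF A(1) i(1) n i(2)]] by blast
    have "path_cost A c n (s + c (n(i := n i - 1)))"
      using path_cost.step[OF s(2) i(1)] i(2) by simp
    with s(1) i(3) show ?thesis by (intro exI[of _ "s + c (n(i := n i - 1))"]) (auto simp: G_def)
  qed
  moreover have "sum F' (level A (Suc k)) / card (level A (Suc k))
      = (\<Sum>j<Suc k. sum c (level A j) / card (level A j))"
  proof -
    have N: "real (Suc k) * card (level A (Suc k)) = real (k + card A) * card (level A k)"
      using card_level_Suc[OF A(1), of k] by (metis of_nat_mult)
    have "sum F' (level A (Suc k)) = real (k + card A) * sum G (level A k) / real (Suc k)"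
      unfolding F'_def sum_divide_distrib[symmetric] sum_level_Suc[OF A(1)] ..
    then have "sum F' (level A (Suc k)) / card (level A (Suc k))
        = real (k + card A) * sum G (level A k) / (real (k + card A) * card (level A k))"
      using N by (simp add: mult.commute)
    also have "\<dots> = sum G (level A k) / card (level A k)"
    proof (rule mult_divide_mult_cancel_left)
      have "card A \<noteq> 0" using A by simp
      then show "real (k + card A) \<noteq> 0" by linarith
    qed
    also have "\<dots> = (\<Sum>j<Suc k. sum c (level A j) / card (level A j))"
      using F(2) by (simp add: G_def sum.distrib add_divide_distrib)
    finally show ?thesis .
  qed
  ultimately show ?case by blast
qed

lemma cheap_path:
  assumes A: "finite A" "A \<noteq> {}"
  shows "\<exists>n\<in>level A k. \<exists>s\<le>(\<Sum>j<k. sum c (level A j) / card (level A j)). path_cost A c n s"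
proof -
  obtain F where F: "\<And>n. n \<in> level A k \<Longrightarrow> \<exists>s\<le>F n. path_cost A c n s"
    "sum F (level A k) / card (level A k) = (\<Sum>j<k. sum c (level A j) / card (level A j))"
    using average_path_cost[OF A, of k c] by blast
  define Y where "Y = sum F (level A k) / card (level A k)"
  obtain e where "card A = Suc e" using A by (cases "card A") auto
  from card_level[OF A(1) this] have pos: "card (level A k) > 0" by simp
  have "\<exists>n\<in>level A k. F n \<le> Y"
  proof (rule ccontr)
    assume "\<not> ?thesis"
    then have "(\<Sum>n\<in>level A k. Y) < sum F (level A k)"
      using pos by (intro sum_strict_mono) (auto simp: card_gt_0_iff not_le)
    then show False using pos by (simp add: Y_def)
  qed
  then show ?thesis using F unfolding Y_def by (metis order_trans)
qed

text \<open>
  With \<open>b = N\<^sub>j\<^bsup>-1/(1-\<tau>)\<^esup>\<close> the interpolation \<open>x\<^sup>\<tau> / N\<^sub>j = x\<^sup>\<tau> * b\<^bsup>1-\<tau>\<^esup> \<le> x + b\<close> separates the lengths,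
  whose total is at most 1, from the contribution \<open>N\<^sub>j * b = N\<^sub>j\<^bsup>-\<tau>/(1-\<tau>)\<^esup>\<close> of a whole level. The latter
  decays like \<open>j\<close> to the power \<open>-(d - 1) * \<tau> / (1 - \<tau>)\<close>, which is summable exactly if \<open>\<tau> > 1 / d\<close>.
\<close>

lemma average_powr_bound:
  assumes A: "finite A" "card A = d" "2 \<le> d" and \<tau>: "1 / real d < \<tau>" "\<tau> < 1"
  shows "\<exists>S. \<forall>l k. (\<forall>n. 0 \<le> l n) \<longrightarrow> (\<Sum>j<k. sum l (level A j)) \<le> 1 \<longrightarrow>
            (\<Sum>j<k. sum (\<lambda>n. l n powr \<tau>) (level A j) / card (level A j)) \<le> S"
proof -
  obtain e where e: "d = Suc e" "e \<ge> 1" using A(3) by (cases d) auto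
  define N where "N j = real (card (level A j))" for j
  define \<beta> where "\<beta> = \<tau> / (1 - \<tau>)"
  have \<tau>0: "0 < \<tau>" using \<tau>(1) A(3) by (smt (verit) divide_nonneg_nonneg of_nat_0_le_iff)
  have \<beta>0: "0 < \<beta>" using \<tau>0 \<tau> by (simp add: \<beta>_def)
  have e\<beta>: "real e * \<beta> > 1" using \<tau> e by (simp add: \<beta>_def field_simps)
  have N1: "1 \<le> N j" for j
  proof -
    have "card (level A j) > 0" using card_level[OF A(1), of e j] A e by simp
    then show ?thesis by (simp add: N_def)
  qed
  have Nge: "(real (Suc j) / real e) ^ e \<le> N j" for j
  proof -
    have "(real (Suc j) / real e) ^ e \<le> (real (j + e) / real e) ^ e"
      using e(2) by (intro power_mono divide_right_mono) auto
    also have "\<dots> \<le> real (j + e choose e)"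
      by (rule binomial_ge_n_over_k_pow_k) simp
    finally show ?thesis using card_level[OF A(1), of e j] A e by (simp add: N_def)
  qed
  define R where "R j = real e powr (real e * \<beta>) * real (Suc j) powr (- (real e * \<beta>))" for j
  have NR: "N j powr (- \<beta>) \<le> R j" for j
  proof -
    have "N j powr (- \<beta>) \<le> ((real (Suc j) / real e) ^ e) powr (- \<beta>)"
      using Nge[of j] \<beta>0 e(2) by (intro powr_mono2') auto
    also have "\<dots> = (real (Suc j) / real e) powr (- (real e * \<beta>))"
      using e(2) by (simp add: powr_powr flip: powr_realpow)
    also have "\<dots> = R j"
      using e(2) by (simp add: R_def powr_divide powr_minus field_simps)
    finally show ?thesis .
  qed
  have "summable (\<lambda>j. real (Suc j) powr (- (real e * \<beta>)))"
    using e\<beta> by (subst summable_Suc_iff) (simp add: summable_real_powr_iff)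
  then have sR: "summable R" unfolding R_def by (rule summable_mult)
  have pw: "x powr \<tau> / N j \<le> x + N j powr (- (1 / (1 - \<tau>)))" if "0 \<le> x" for x j
  proof -
    define b where "b = N j powr (- (1 / (1 - \<tau>)))"
    have b0: "0 \<le> b" by (simp add: b_def)
    have "b powr (1 - \<tau>) = 1 / N j"
      using \<tau>(2) N1[of j] unfolding b_def powr_powr
      by (simp add: powr_minus_divide)
    then have "x powr \<tau> / N j = x powr \<tau> * b powr (1 - \<tau>)" by simp
    also have "\<dots> \<le> (x + b) powr \<tau> * (x + b) powr (1 - \<tau>)"
      using that b0 \<tau>0 \<tau>(2) by (intro mult_mono powr_mono2) auto
    also have "\<dots> = x + b" using that b0 by (simp flip: powr_add)
    finally show ?thesis unfolding b_def .
  qed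
  have "(\<Sum>j<k. sum (\<lambda>n. l n powr \<tau>) (level A j) / card (level A j)) \<le> 1 + suminf R"
    if l: "\<And>n. 0 \<le> l n" "(\<Sum>j<k. sum l (level A j)) \<le> 1" for l k
  proof -
    have "sum (\<lambda>n. l n powr \<tau>) (level A j) / card (level A j) \<le> sum l (level A j) + R j" for j
    proof -
      have "sum (\<lambda>n. l n powr \<tau>) (level A j) / card (level A j) = (\<Sum>n\<in>level A j. l n powr \<tau> / N j)"
        by (simp add: N_def sum_divide_distrib)
      also have "\<dots> \<le> (\<Sum>n\<in>level A j. l n + N j powr (- (1 / (1 - \<tau>))))"
        by (intro sum_mono pw l)
      also have "\<dots> = sum l (level A j) + N j powr 1 * N j powr (- (1 / (1 - \<tau>)))"
        using N1[of j] by (simp add: sum.distrib N_def)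
      also have "N j powr 1 * N j powr (- (1 / (1 - \<tau>))) = N j powr (- \<beta>)"
      proof -
        have "1 + - (1 / (1 - \<tau>)) = - \<beta>" using \<tau>(2) by (simp add: \<beta>_def field_simps)
        then show ?thesis by (metis powr_add)
      qed
      finally show ?thesis using NR[of j] by linarith
    qed
    then have "(\<Sum>j<k. sum (\<lambda>n. l n powr \<tau>) (level A j) / card (level A j))
        \<le> (\<Sum>j<k. sum l (level A j) + R j)" by (intro sum_mono)
    also have "\<dots> \<le> 1 + suminf R"
      unfolding sum.distrib using l(2) by (intro add_mono sum_le_suminf sR) (auto simp: R_def)
    finally show ?thesis .
  qed
  then show ?thesis by blast
qed


section \<open>Walking through the intervals\<close>

lemma open_interval_eq_Inf_Sup:
  fixes J :: "real set"
  assumes J: "open J" "is_interval J" "J \<noteq> {}" "J \<subseteq> {0<..<1}"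
  shows "J = {Inf J<..<Sup J}"
proof (intro equalityI subsetI)
  have bdd: "bdd_below J" "bdd_above J"
    by (rule bdd_belowI[of _ 0] bdd_aboveI[of _ 1], use J(4) in fastforce)+
  fix x assume "x \<in> J"
  then obtain e where e: "e > 0" "ball x e \<subseteq> J" using J(1) openE by blast
  then have "x - e/2 \<in> J" "x + e/2 \<in> J" by (auto simp: dist_real_def)
  then have "Inf J \<le> x - e/2" "x + e/2 \<le> Sup J" using bdd by (auto intro: cInf_lower cSup_upper)
  then show "x \<in> {Inf J<..<Sup J}" using e(1) by auto
next
  fix x assume x: "x \<in> {Inf J<..<Sup J}"
  obtain u v where "u \<in> J" "u < x" "v \<in> J" "x < v"
    using x J(3) cInf_lessD[of J x] less_cSupD[of J x] by auto
  then show "x \<in> J" using J(2) unfolding is_interval_1 by (meson less_imp_le)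
qed

lemma sum_lengths_le_1:
  fixes a b :: "'i \<Rightarrow> real"
  assumes "finite B" and disj: "disjoint_family_on (\<lambda>n. {a n<..<b n}) B"
    and le: "\<And>n. n \<in> B \<Longrightarrow> a n \<le> b n" and sub: "\<And>n. n \<in> B \<Longrightarrow> {a n<..<b n} \<subseteq> {0..1}"
  shows "(\<Sum>n\<in>B. b n - a n) \<le> 1"
proof -
  have "(\<Sum>n\<in>B. b n - a n) = (\<Sum>n\<in>B. measure lborel {a n<..<b n})"
    by (rule sum.cong) (auto simp: le)
  also have "\<dots> = measure lborel (\<Union>n\<in>B. {a n<..<b n})"
    by (rule measure_finite_Union[symmetric]) (use assms in auto)
  also have "\<dots> \<le> measure lborel {0..1::real}"
    by (rule measure_mono_fmeasurable)
       (use sub assms(1) in \<open>auto simp: fmeasurable_def intro!: sets.finite_UN\<close>)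
  finally show ?thesis by simp
qed

lemma path_realization:
  fixes f :: "nat \<Rightarrow> real \<Rightarrow> real" and J :: "(nat \<Rightarrow> nat) \<Rightarrow> real set"
  assumes path: "path_cost A c n s"
    and J: "\<And>n. J n \<subseteq> {0..1}"
    and inj: "\<And>i. i \<in> A \<Longrightarrow> inj_on (f i) {0..1}"
    and image: "\<And>i n. i \<in> A \<Longrightarrow> f i ` J n = J (n(i := Suc (n i)))"
    and dist: "\<And>i n. i \<in> A \<Longrightarrow> distortion_le (f i) (J n) (exp (M * c n))"
    and comm: "\<And>i x. i \<in> A \<Longrightarrow> x \<in> {0..1} \<Longrightarrow> f i (g x) = g (f i x)"
    and g: "g ` J (\<lambda>_. 0) \<subseteq> J (\<lambda>_. 0)"
  shows "\<exists>h. h ` J (\<lambda>_. 0) = J n \<and> inj_on h (J (\<lambda>_. 0)) \<and>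
            (\<forall>x\<in>J (\<lambda>_. 0). h (g x) = g (h x)) \<and> distortion_le h (J (\<lambda>_. 0)) (exp (M * s))"
  using path
proof induction
  case start
  show ?case by (rule exI[of _ "\<lambda>x. x"]) (auto simp: distortion_le_def mult.commute)
next
  case (step n s i)
  then obtain h where h: "h ` J (\<lambda>_. 0) = J n" "inj_on h (J (\<lambda>_. 0))"
    "\<And>x. x \<in> J (\<lambda>_. 0) \<Longrightarrow> h (g x) = g (h x)" "distortion_le h (J (\<lambda>_. 0)) (exp (M * s))"
    by blast
  have "(f i \<circ> h) ` J (\<lambda>_. 0) = J (n(i := Suc (n i)))"
    by (simp only: image_comp[symmetric] image[OF step(2)] h(1))
  moreover have "inj_on (f i \<circ> h) (J (\<lambda>_. 0))"
    using h(1,2) inj_on_subset[OF inj[OF step(2)] J] by (simp add: comp_inj_on)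
  moreover have "(f i \<circ> h) (g x) = g ((f i \<circ> h) x)" if "x \<in> J (\<lambda>_. 0)" for x
      proof -
    have "h x \<in> {0..1}" using h(1) J[of n] that by blast
    then show ?thesis using h(3)[OF that] comm[OF step(2)] by simp
  qed
  moreover have "distortion_le (f i \<circ> h) (J (\<lambda>_. 0)) (exp (M * s) * exp (M * c n))"
    by (rule distortion_le_comp[OF h(4) dist[OF step(2)] h(2)]) (use h(1) in auto)
  then have "distortion_le (f i \<circ> h) (J (\<lambda>_. 0)) (exp (M * (s + c n)))"
    by (simp add: distrib_left exp_add)
  ultimately show ?case by blast
qed

text \<open>
  The orbit of \<open>x\<close> is monotone and bounded, hence convergent, so its increments tend to 0.
\<close>

lemma fixed_point_if_displacement_bounded_below:
  fixes g :: "real \<Rightarrow> real"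
  assumes mono: "strict_mono_on {0..1} g" and g: "g ` {0..1} \<subseteq> {0..1}" and x: "x \<in> {0..1}"
    and c: "c > 0" "\<And>m. c * \<bar>g x - x\<bar> \<le> \<bar>(g ^^ Suc m) x - (g ^^ m) x\<bar>"
  shows "g x = x"
proof -
  define X where "X m = (g ^^ m) x" for m
  have X: "X m \<in> {0..1}" for m unfolding X_def
    by (induction m) (use x g in \<open>simp_all add: image_subset_iff\<close>)
  have X_Suc: "X (Suc m) = g (X m)" for m by (simp add: X_def)
  have gle: "g u \<le> g v" if "u \<le> v" "u \<in> {0..1}" "v \<in> {0..1}" for u v
    using strict_mono_on_leD[OF mono] that by blast
  have "monoseq X"
  proof (cases "x \<le> g x")
    case True
    have "X m \<le> X (Suc m)" for m
    proof (induction m)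
      case 0
      then show ?case using True by (simp add: X_def)
    next
      case (Suc m)
      then show ?case using gle[OF Suc X X] by (simp only: X_Suc)
    qed
    then show ?thesis by (intro monoI1 allI impI) (simp add: lift_Suc_mono_le)
  next
    case False
    have "X (Suc m) \<le> X m" for m
    proof (induction m)
      case 0
      then show ?case using False by (simp add: X_def)
    next
      case (Suc m)
      then show ?case using gle[OF Suc X X] by (simp only: X_Suc)
    qed
    then show ?thesis by (intro monoI2 allI impI) (simp add: lift_Suc_antimono_le)
  qed
  moreover have "Bseq X" by (rule BseqI'[of _ 1]) (use X in auto)
  ultimately obtain L where L: "X \<longlonglongrightarrow> L"
    using Bseq_monoseq_convergent convergent_def by blast
  have "(\<lambda>m. \<bar>X (Suc m) - X m\<bar>) \<longlonglongrightarrow> \<bar>L - L\<bar>"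
    by (intro tendsto_intros LIMSEQ_Suc L)
  then have "c * \<bar>g x - x\<bar> \<le> \<bar>L - L\<bar>"
    using c(2) by (intro LIMSEQ_le_const) (auto simp: X_def)
  then show ?thesis using c(1) by (simp add: mult_le_0_iff)
qed

theorem mainTheorem2:
  fixes d :: nat and \<epsilon> :: real
    and f :: "nat \<Rightarrow> real \<Rightarrow> real"
    and I :: "(nat \<Rightarrow> int) \<Rightarrow> real set"
  assumes "d \<ge> 2" and "\<epsilon> > 0"
    and "\<And>i. i \<in> {1..d+1} \<Longrightarrow> diffeo_plus (f i)"
    and "\<And>i j x. i \<in> {1..d+1} \<Longrightarrow> j \<in> {1..d+1} \<Longrightarrow> x \<in> {0..1} \<Longrightarrow> f i (f j x) = f j (f i x)"
    and "\<And>n. n \<in> Zd d \<Longrightarrow> open (I n) \<and> is_interval (I n) \<and> I n \<noteq> {} \<and> I n \<subseteq> {0<..<1}"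
    and "disjoint_family_on I (Zd d)"
    and "\<And>n m x y. n \<in> Zd d \<Longrightarrow> m \<in> Zd d \<Longrightarrow> less_fun n m \<Longrightarrow> x \<in> I n \<Longrightarrow> y \<in> I m \<Longrightarrow> x < y"
    and "\<And>n i. n \<in> Zd d \<Longrightarrow> i \<in> {1..d} \<Longrightarrow> f i ` I n = I (n(i := n i - 1))"
    and "\<And>n. n \<in> Zd d \<Longrightarrow> f (d+1) ` I n = I n"
    and "\<And>i. i \<in> {1..d} \<Longrightarrow> class_C (1 + 1 / real d + \<epsilon>) (f i)"
  shows "\<forall>x \<in> (\<Union>n\<in>Zd d. I n). f (d+1) x = x"
proof clarify
  fix p x assume p: "p \<in> Zd d" and x: "x \<in> I p"
  define A where "A = {1..d}"
  have A: "finite A" "card A = d" "A \<noteq> {}" using assms(1) by (auto simp: A_def)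
  define g where "g = f (d+1)"
  \<comment> \<open>Any exponent in \<open>(1/d, 1)\<close> that is at most \<open>1/d + \<epsilon>\<close> serves; \<open>3/4\<close> exceeds \<open>1/d \<le> 1/2\<close>.\<close>
  define \<tau> where "\<tau> = min (1 / real d + \<epsilon>) (3/4)"
  have d2: "1 / real d \<le> 1/2" using assms(1) by (simp add: field_simps)
  have \<tau>: "1 / real d < \<tau>" "\<tau> < 1" "0 < \<tau>" "1 + \<tau> \<le> 1 + 1 / real d + \<epsilon>"
  proof -
    have "1 / real d < 3/4" "0 < 1 / real d + \<epsilon>" using d2 assms(2) by (simp_all add: add_nonneg_pos)
    then show "1 / real d < \<tau>" "\<tau> < 1" "0 < \<tau>" "1 + \<tau> \<le> 1 + 1 / real d + \<epsilon>"
      using assms(2) by (simp_all add: \<tau>_def)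
  qed
  have gd: "diffeo_plus g" unfolding g_def by (rule assms(3)) simp
  then have g01: "g ` {0..1} \<subseteq> {0..1}" and gmono: "strict_mono_on {0..1} g"
    by (auto simp: diffeo_plus_def bij_betw_def)

  \<comment> \<open>Each generator lowers its coordinate by 1, so paths with natural steps start at \<open>p\<close> and descend.\<close>
  define idx :: "(nat \<Rightarrow> nat) \<Rightarrow> nat \<Rightarrow> int"
    where "idx n = restrict (\<lambda>i. p i - int (n i)) A" for n
  have idx: "idx n \<in> Zd d" for n by (auto simp: idx_def Zd_def A_def)
  have idx0: "idx (\<lambda>_. 0) = p"
    using p by (auto simp: idx_def Zd_def A_def PiE_def extensional_def restrict_def)
  have idx_Suc: "idx (n(i := Suc (n i))) = (idx n)(i := idx n i - 1)" if "i \<in> A" for n i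
    using that by (auto simp: idx_def fun_eq_iff)
  define J where "J n = I (idx n)" for n
  define a b l where "a n = Inf (J n)" and "b n = Sup (J n)" and "l n = b n - a n" for n
  have Jab: "J n = {a n<..<b n}" for n
    unfolding a_def b_def J_def using assms(5)[OF idx] by (intro open_interval_eq_Inf_Sup) auto
  have J01: "J n \<subseteq> {0..1}" and Jne: "J n \<noteq> {}" for n
    using assms(5)[OF idx[of n]] by (force simp: J_def)+
  have l0: "0 \<le> l n" for n using Jne[of n] by (auto simp: Jab l_def)
  have gJ: "g ` J n = J n" for n unfolding J_def g_def by (rule assms(9)[OF idx])
  have J0: "J (\<lambda>_. 0) = I p" by (simp add: J_def idx0)

  have total: "(\<Sum>j<k. sum l (level A j)) \<le> 1" for k
  proof -
    define B where "B = (\<Union>j<k. level A j)"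
    have inj: "inj_on idx B"
    proof (rule inj_onI)
      fix m n assume "m \<in> B" "n \<in> B" "idx m = idx n"
      then have "m i = n i" for i
        by (cases "i \<in> A") (auto simp: B_def level_def idx_def dest: fun_cong[of _ _ i])
      then show "m = n" ..
    qed
    have "(\<Sum>j<k. sum l (level A j)) = sum l B" unfolding B_def
      by (rule sum.UNION_disjoint[symmetric]) (auto simp: finite_level A, auto simp: level_def)
    also have "\<dots> \<le> 1" unfolding l_def
    proof (rule sum_lengths_le_1)
      show "finite B" by (simp add: B_def finite_level A)
      show "disjoint_family_on (\<lambda>n. {a n<..<b n}) B"
        using assms(6) idx inj unfolding Jab[symmetric] J_def disjoint_family_on_def
        by (metis inj_onD)
      show "a n \<le> b n" for n using l0[of n] by (simp add: l_def)
      show "{a n<..<b n} \<subseteq> {0..1}" for n using J01[of n] Jab by simp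
    qed
    finally show ?thesis .
  qed

  define c where "c n = l n powr \<tau>" for n
  obtain S where S: "\<And>k. (\<Sum>j<k. sum c (level A j) / card (level A j)) \<le> S"
    using average_powr_bound[OF A(1,2) assms(1) \<tau>(1,2)] l0 total unfolding c_def by blast

  have "\<exists>M\<ge>0. \<forall>a b. {a<..<b} \<subseteq> {0..1} \<longrightarrow>
          distortion_le (f i) {a<..<b} (exp (M * (b - a) powr \<tau>))" if "i \<in> A" for i
    using that assms(3,10) \<tau> by (intro diffeo_plus_distortion_le) (auto simp: A_def)
  then obtain M' where M': "\<And>i. i \<in> A \<Longrightarrow> 0 \<le> M' i"
    "\<And>i a b. i \<in> A \<Longrightarrow> {a<..<b} \<subseteq> {0..1} \<Longrightarrow>
       distortion_le (f i) {a<..<b} (exp (M' i * (b - a) powr \<tau>))" by metis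
  define M where "M = sum M' A"
  have M0: "0 \<le> M" unfolding M_def by (rule sum_nonneg) (rule M'(1))
  have dist: "distortion_le (f i) (J n) (exp (M * c n))" if "i \<in> A" for i n
  proof (rule distortion_le_mono)
    show "distortion_le (f i) (J n) (exp (M' i * c n))"
      using M'(2)[OF that] J01[of n] unfolding Jab c_def l_def by blast
    have "M' i \<le> M" unfolding M_def by (rule member_le_sum) (use that M' A in auto)
    then show "exp (M' i * c n) \<le> exp (M * c n)" by (simp add: c_def mult_right_mono)
  qed

  obtain D where D: "\<And>y. y \<in> {0..1} \<Longrightarrow> (g has_real_derivative D y) (at y within {0..1})"
    "continuous_on {0..1} D"
    using gd class_C_1_derivative unfolding diffeo_plus_def by metis

  have "1 / (2 * exp (M * S)) * \<bar>g x - x\<bar> \<le> \<bar>(g ^^ Suc m) x - (g ^^ m) x\<bar>" for m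
  proof (cases "g x = x")
    case False
    obtain E where E: "\<And>y. y \<in> {0..1} \<Longrightarrow> (g ^^ m has_real_derivative E y) (at y within {0..1})"
      "continuous_on {0..1} E" using funpow_C1[OF D g01, of m] by blast
    obtain \<delta> where \<delta>: "\<delta> > 0" "\<And>a b u v. {a<..<b} \<subseteq> {0..1} \<Longrightarrow> b - a < \<delta> \<Longrightarrow>
        (g ^^ m) ` {a<..<b} = {a<..<b} \<Longrightarrow> u \<in> {a<..<b} \<Longrightarrow> v \<in> {a<..<b} \<Longrightarrow>
        \<bar>u - v\<bar> / 2 \<le> \<bar>(g ^^ m) u - (g ^^ m) v\<bar>"
      using no_contraction_on_short_invariant_interval[OF E] by blast
    have "summable (\<lambda>j. sum l (level A j))"
      by (rule summableI_nonneg_bounded[OF _ total]) (simp add: sum_nonneg l0)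
    then have "(\<lambda>j. sum l (level A j)) \<longlonglongrightarrow> 0" by (rule summable_LIMSEQ_zero)
    then obtain K where K: "sum l (level A K) < \<delta>"
      using order_tendstoD(2)[OF _ \<delta>(1)] eventually_sequentially by (metis order_refl)
    obtain n s where n: "n \<in> level A K" "path_cost A c n s"
        "s \<le> (\<Sum>j<K. sum c (level A j) / card (level A j))"
      using cheap_path[OF A(1,3), of K c] by blast
    have "s \<le> S" using n(3) S[of K] by linarith
    have "\<exists>h. h ` J (\<lambda>_. 0) = J n \<and> inj_on h (J (\<lambda>_. 0)) \<and>
            (\<forall>x\<in>J (\<lambda>_. 0). h (g x) = g (h x)) \<and> distortion_le h (J (\<lambda>_. 0)) (exp (M * s))"
    proof (rule path_realization[where f = f, OF n(2) J01 _ _ dist])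
      show "inj_on (f i) {0..1}" if "i \<in> A" for i
        using assms(3)[of i] that by (auto simp: A_def diffeo_plus_def bij_betw_def)
      show "f i ` J n = J (n(i := Suc (n i)))" if "i \<in> A" for i n
        using assms(8)[OF idx, of i n] idx_Suc[OF that] that by (simp add: J_def A_def)
      show "f i (g x) = g (f i x)" if "i \<in> A" "x \<in> {0..1}" for i x
        using assms(4)[of i "d+1" x] that by (simp add: g_def A_def)
    qed (use gJ in auto)
    then obtain h where h: "h ` I p = J n" "inj_on h (I p)"
      "\<And>y. y \<in> I p \<Longrightarrow> h (g y) = g (h y)" "distortion_le h (I p) (exp (M * s))"
      unfolding J0 by blast
    have gIp: "(g ^^ k) y \<in> I p" if "y \<in> I p" for k y
      using that by (induction k) (use gJ[of "\<lambda>_. 0"] J0 in auto)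
    have hg: "h ((g ^^ k) y) = (g ^^ k) (h y)" if "y \<in> I p" for k y
      by (induction k) (auto simp: h(3) gIp[OF that])
    have gx: "g x \<in> I p" using gIp[OF x, of 1] by simp
    define X Y where "X = (g ^^ m) x" and "Y = (g ^^ Suc m) x"
    have XY: "X \<in> I p" "Y \<in> I p" unfolding X_def Y_def by (rule gIp[OF x])+
    have gmJ: "(g ^^ m) ` J n = J n" 
    proof (induction m)
      case (Suc m)
      then show ?case by (simp only: funpow.simps image_comp[symmetric] gJ)
    qed simp
    have "l n \<le> sum l (level A K)"
      by (rule member_le_sum[OF n(1) _ finite_level[OF A(1)]]) (rule l0)
    then have small: "b n - a n < \<delta>" using K unfolding l_def by linarith
    have "h (g x) \<in> {a n<..<b n}" "h x \<in> {a n<..<b n}"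
      unfolding Jab[symmetric] h(1)[symmetric] by (rule imageI, fact)+
    \<comment> \<open>Transport the estimate for \<open>g\<^sup>m\<close> on the short interval back to \<open>I p\<close> by \<open>h\<close>.\<close>
    from \<delta>(2)[OF _ small _ this] have "\<bar>h (g x) - h x\<bar> / 2 \<le> \<bar>(g ^^ m) (h (g x)) - (g ^^ m) (h x)\<bar>"
      using J01[of n] gmJ unfolding Jab by blast
    also have "\<dots> = \<bar>h Y - h X\<bar>"
      unfolding X_def Y_def funpow_Suc_right o_apply hg[OF gx] hg[OF x] ..
    finally have "\<bar>h (g x) - h x\<bar> / 2 * \<bar>g x - x\<bar> \<le> \<bar>h Y - h X\<bar> * \<bar>g x - x\<bar>"
      by (rule mult_right_mono) simp
    also have "\<dots> \<le> exp (M * s) * (\<bar>h (g x) - h x\<bar> * \<bar>Y - X\<bar>)"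
      using h(4) XY x gx unfolding distortion_le_def by blast
    also have "\<dots> \<le> exp (M * S) * (\<bar>h (g x) - h x\<bar> * \<bar>Y - X\<bar>)"
      using \<open>s \<le> S\<close> M0 by (intro mult_right_mono) (auto intro: mult_left_mono)
    finally have "\<bar>h (g x) - h x\<bar> * (\<bar>g x - x\<bar> / 2) \<le> \<bar>h (g x) - h x\<bar> * (exp (M * S) * \<bar>Y - X\<bar>)"
      by (simp add: mult_ac)
    moreover have "h (g x) \<noteq> h x" using h(2) False x gx by (auto dest: inj_onD)
    ultimately have "\<bar>g x - x\<bar> / 2 \<le> exp (M * S) * \<bar>Y - X\<bar>" by simp
    then have "1 / (2 * exp (M * S)) * \<bar>g x - x\<bar> \<le> \<bar>Y - X\<bar>" by (simp add: field_simps)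
    then show ?thesis unfolding X_def Y_def .
  qed simp
  moreover have "x \<in> {0..1}" using x J0 J01[of "\<lambda>_. 0"] by auto
  ultimately have "g x = x"
    by (intro fixed_point_if_displacement_bounded_below[OF gmono g01, of x "1 / (2 * exp (M * S))"]) auto
  then show "f (d+1) x = x" by (simp add: g_def)
qed

end
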